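(* Let $G=(V,E)$ be an Eulerian directed multigraph with $V=[n]$ and $|E|=m\ge 1$, given with fixed orderings of the incoming and outgoing edges at each vertex. Run Algorithm \textsc{Space-Efficient-Hierholzer} (described in the context) on $G$, and let $u_0u_1, u_1u_2, \dots, u_{m-1}u_m$ be the sequence of edges it writes, in order. Then this sequence is an Eulerian cycle of $G$: $u_m=u_0$, and for every ordered pair $(x,y)$ of vertices, the number of indices $j$ with $(u_j,u_{j+1})=(x,y)$ equals the number of edges from $x$ to $y$ in $G$.
   Context: $G=(V,E)$ is a finite directed multigraph (loops and parallel edges allowed), $V=[n]=\{1,\dots,n\}$, $E$ a multiset of $m$ directed edges; $uv$ denotes an edge from $u$ to $v$. $d^+(v)$ and $d^-(v)$ are the out- and in-degree of $v$. $G$ is Eulerian: it is strongly connected (for every ordered pair of vertices there is a directed path between them) and $d^+(v)=d^-(v)$ for all $v$. An Eulerian cycle is a closed trail using every edge exactly once. For each vertex $v$ the outgoing edges and the incoming edges are each listed in an arbitrary fixed order; $\Gamma^+(v,i)$ is the head of the $i$-th outgoing edge of $v$ ($1\le i\le d^+(v)$) and $\Gamma^-(v,i)$ is the tail of the $i$-th incoming edge of $v$ ($1\le i\le d^-(v)$). Algorithm \textsc{Space-Efficient-Hierholzer}: initialise integer arrays $\texttt{next}[1..n]$, $\texttt{visited}[1..n]$, $\texttt{skipped}[1..n]$, $B[1..n]$ to all zeros and $c\gets 0$. Pick an arbitrary $v_0\in[n]$, set $u\gets v_0$ and $\texttt{visited}[u]\gets 1$. While $c<m$: set $\texttt{next}[u]\gets\texttt{next}[u]+1$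 and $i\gets\texttt{next}[u]$. If $i\le d^-(u)$: let $v\gets\Gamma^-(u,i)$; if $\texttt{visited}[v]=0$ then (if $v\ne v_0$ set $B[v]\gets u$) and set $\texttt{visited}[v]\gets 1$; then set $u\gets v$. Otherwise ($i>d^-(u)$): set $i\gets \texttt{next}[u]-d^-(u)$; if $\Gamma^+(u,i)=B[u]$ and $\texttt{skipped}[u]=0$, then set $\texttt{skipped}[u]\gets 1$, $\texttt{next}[u]\gets\texttt{next}[u]+1$, $i\gets i+1$ (the test $\Gamma^+(u,i)=B[u]$ is taken to be false if $i>d^+(u)$). Then if $i>d^+(u)$ let $v\gets B[u]$, else let $v\gets \Gamma^+(u,i)$; write the edge $uv$ to the output, set $c\gets c+1$ and $u\gets v$. *)

theory Defs
  imports "Graph_Theory.Euler" "HOL-Library.While_Combinator"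
begin

definition eulerian_digraph :: "('a, 'b) pre_digraph \<Rightarrow> bool" where
  "eulerian_digraph G \<longleftrightarrow>
     strongly_connected G \<and> (\<forall>v \<in> verts G. out_degree G v = in_degree G v)"

definition arc_orders ::
  "('a, 'b) pre_digraph \<Rightarrow> ('a \<Rightarrow> 'b list) \<Rightarrow> ('a \<Rightarrow> 'b list) \<Rightarrow> bool" where
  "arc_orders G outs ins \<longleftrightarrow>
     (\<forall>v \<in> verts G. distinct (outs v) \<and> set (outs v) = out_arcs G v \<and>
                    distinct (ins v) \<and> set (ins v) = in_arcs G v)"

(* The index i counts from 1; the algorithm only uses i up to the respective degree. *)
definition Gamma_out :: "('a, 'b) pre_digraph \<Rightarrow> ('a \<Rightarrow> 'b list) \<Rightarrow> 'a \<Rightarrow> nat \<Rightarrow> 'a" where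
  "Gamma_out G outs v i = head G (outs v ! (i - 1))"

definition Gamma_in :: "('a, 'b) pre_digraph \<Rightarrow> ('a \<Rightarrow> 'b list) \<Rightarrow> 'a \<Rightarrow> nat \<Rightarrow> 'a" where
  "Gamma_in G ins v i = tail G (ins v ! (i - 1))"

(* Arrays indexed by 1..n are total functions; only the entries at vertices matter.
   The field outp is the output stream, oldest edge first. *)
record hstate =
  nxt :: "nat \<Rightarrow> nat"
  visited :: "nat \<Rightarrow> nat"
  skipped :: "nat \<Rightarrow> nat"
  B :: "nat \<Rightarrow> nat"
  cnt :: nat
  cur :: nat
  outp :: "(nat \<times> nat) list"

definition hinit :: "nat \<Rightarrow> hstate" where
  "hinit v0 = \<lparr> nxt = (\<lambda>_. 0), visited = (\<lambda>_. 0)(v0 := 1), skipped = (\<lambda>_. 0), B = (\<lambda>_. 0),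
                cnt = 0, cur = v0, outp = [] \<rparr>"

(* Both branches of the loop body run after next[u] has been incremented. *)
definition backward_step ::
  "(nat, 'b) pre_digraph \<Rightarrow> (nat \<Rightarrow> 'b list) \<Rightarrow> nat \<Rightarrow> hstate \<Rightarrow> hstate" where
  "backward_step G ins v0 s =
     (let u = cur s;
          v = Gamma_in G ins u (nxt s u);
          s' = (if visited s v = 0
                then s\<lparr> B := (if v \<noteq> v0 then (B s)(v := u) else B s),
                        visited := (visited s)(v := 1) \<rparr>
                else s)
      in s'\<lparr> cur := v \<rparr>)"

definition forward_step ::
  "(nat, 'b) pre_digraph \<Rightarrow> (nat \<Rightarrow> 'b list) \<Rightarrow> hstate \<Rightarrow> hstate" where
  "forward_step G outs s =
     (let u = cur s;
          i = nxt s u - in_degree G u;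
          skip = (i \<le> out_degree G u \<and> Gamma_out G outs u i = B s u \<and> skipped s u = 0);
          s' = (if skip
                then s\<lparr> skipped := (skipped s)(u := 1), nxt := (nxt s)(u := nxt s u + 1) \<rparr>
                else s);
          i' = (if skip then i + 1 else i);
          v = (if i' > out_degree G u then B s' u else Gamma_out G outs u i')
      in s'\<lparr> outp := outp s' @ [(u, v)], cnt := cnt s' + 1, cur := v \<rparr>)"

definition hstep ::
  "(nat, 'b) pre_digraph \<Rightarrow> (nat \<Rightarrow> 'b list) \<Rightarrow> (nat \<Rightarrow> 'b list) \<Rightarrow> nat \<Rightarrow> hstate \<Rightarrow> hstate" where
  "hstep G outs ins v0 s =
     (let u = cur s;
          s' = s\<lparr> nxt := (nxt s)(u := nxt s u + 1) \<rparr>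
      in if nxt s' u \<le> in_degree G u then backward_step G ins v0 s' else forward_step G outs s')"

(* The result is None iff the loop does not terminate. *)
definition space_efficient_hierholzer ::
  "(nat, 'b) pre_digraph \<Rightarrow> (nat \<Rightarrow> 'b list) \<Rightarrow> (nat \<Rightarrow> 'b list) \<Rightarrow> nat \<Rightarrow> (nat \<times> nat) list option"
where
  "space_efficient_hierholzer G outs ins v0 =
     map_option outp
       (while_option (\<lambda>s. cnt s < card (arcs G)) (hstep G outs ins v0) (hinit v0))"

end

theory Submission
  imports Defs
begin

text \<open>
  The in-arcs are consumed by backward walks.  When all in-arcs of the current vertex \<open>u\<close> have been
  consumed, the balance of the consumed arcs shows that the backward walk has closed up at the end
  of the output trail and that all out-arcs of \<open>u\<close> are consumed as well; hence all heads of
  out-arcs of \<open>u\<close> have been visited, and \<open>B u\<close> is final.  From then on \<open>u\<close> is left along its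
  out-arcs in the given order, except that one arc to \<open>B u\<close> is saved for the end.

  The output is therefore a trail that uses the tree arc of a vertex last.  If it got stuck, it
  would be stuck at \<open>v0\<close>, with all arcs into \<open>v0\<close> used.  A vertex whose tree arc is used has all its
  out-arcs used, so, by balance, also all its in-arcs; going up the tree, this holds for all visited
  vertices.  As the visited vertices are then closed under predecessors, strong connectivity shows
  that all arcs have been used.
\<close>

section \<open>Arc balance\<close>

context wf_digraph
begin

lemma arc_set_balance_insert:
  assumes "e \<in> arcs G" "e \<notin> A" "finite A"
  shows "arc_set_balance w (insert e A)
    = arc_set_balance w A + of_bool (head G e = w) - of_bool (tail G e = w)"
  using assms by (cases "head G e = w"; cases "tail G e = w") (auto simp: arc_set_balance_def)

text \<open>Balance is in-arcs minus out-arcs. A set balanced from x to v has the degree profile of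
  a trail from x to v, and adding \<open>e\<close> acts like prepending it to that trail; this is
  one step of the backward walk.\<close>

lemma arc_set_balanced_insert_tail:
  assumes "e \<in> arcs G" "e \<notin> A" "finite A" "arc_set_balanced (head G e) A v"
  shows "arc_set_balanced (tail G e) (insert e A) v"
proof -
  note ins = arc_set_balance_insert[OF assms(1-3)]
  show ?thesis
  proof (cases "head G e = v")
    case True
    then show ?thesis
      using assms(4) tail_in_verts[OF assms(1)] head_in_verts[OF assms(1)]
      by (auto simp: arc_set_balanced_def ins)
  next
    case False
    then show ?thesis
      using assms(4) tail_in_verts[OF assms(1)] head_in_verts[OF assms(1)]
      by (cases "tail G e = v"; cases "tail G e = head G e") (auto simp: arc_set_balanced_def ins)
  qed
qed

lemma arc_set_balanced_refl_iff: "arc_set_balanced u A u \<longleftrightarrow> arc_set_balanced v A v"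
  by (simp add: arc_set_balanced_def)

end

context fin_digraph
begin

text \<open>Once all in-arcs of \<open>u\<close> lie in \<open>A\<close>, equality of degrees makes
  the balance of \<open>u\<close> nonnegative. The start of an open trail has balance -1, so
  \<open>u = v\<close>, and balance 0 then forces all out-arcs into \<open>A\<close>.\<close>

lemma arc_set_balanced_in_arcs_subset:
  assumes "arc_set_balanced u A v" "u \<in> verts G" "out_degree G u = in_degree G u" "in_arcs G u \<subseteq> A"
  shows "u = v \<and> out_arcs G u \<subseteq> A"
proof -
  have *: "card (out_arcs G u \<inter> A) \<le> out_degree G u"
    unfolding out_degree_def by (intro card_mono) auto
  have "in_arcs G u \<inter> A = in_arcs G u" using assms(4) by auto
  then have bal: "arc_set_balance u A = int (out_degree G u) - int (card (out_arcs G u \<inter> A))"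
    using assms(3) by (simp add: arc_set_balance_def in_degree_def)
  then have uv: "u = v" using assms(1) * by (auto simp: arc_set_balanced_def split: if_splits)
  then have "arc_set_balance u A = 0" using assms(1,2) by (auto simp: arc_set_balanced_def)
  then have "card (out_arcs G u \<inter> A) = card (out_arcs G u)" using bal by (simp add: out_degree_def)
  then have "out_arcs G u \<inter> A = out_arcs G u" by (intro card_subset_eq) auto
  then show ?thesis using uv by auto
qed

text \<open>Mirror image at the end \<open>v\<close>: the balance of \<open>v\<close> is at most 0,
  whereas the end of an open trail has balance 1.\<close>

lemma arc_set_balanced_out_arcs_subset:
  assumes "arc_set_balanced u A v" "v \<in> verts G" "out_degree G v = in_degree G v" "out_arcs G v \<subseteq> A"
  shows "u = v \<and> in_arcs G v \<subseteq> A"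
proof -
  have *: "card (in_arcs G v \<inter> A) \<le> in_degree G v"
    unfolding in_degree_def by (intro card_mono) auto
  have "out_arcs G v \<inter> A = out_arcs G v" using assms(4) by auto
  then have bal: "arc_set_balance v A = int (card (in_arcs G v \<inter> A)) - int (in_degree G v)"
    using assms(3) by (simp add: arc_set_balance_def out_degree_def)
  then have uv: "u = v" using assms(1) * by (auto simp: arc_set_balanced_def split: if_splits)
  then have "arc_set_balance v A = 0" using assms(1,2) by (auto simp: arc_set_balanced_def)
  then have "card (in_arcs G v \<inter> A) = card (in_arcs G v)" using bal by (simp add: in_degree_def)
  then have "in_arcs G v \<inter> A = in_arcs G v" by (intro card_subset_eq) auto
  then show ?thesis using uv by auto
qed

lemma in_degree_eq_out_degree_imp_closed:
  assumes "trail u p v" "set p = arcs G"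
    and "\<And>w. w \<in> verts G \<Longrightarrow> out_degree G w = in_degree G w"
  shows "u = v"
proof -
  have "v \<in> verts G" using assms(1) by (auto simp: trail_def)
  then show ?thesis
    using arc_set_balanced_out_arcs_subset[OF arc_balancedI_trail[OF assms(1)]] assms(2,3)
    by (simp add: subset_iff)
qed

end

lemma (in wf_digraph) strongly_connected_imp_connected:
  assumes "strongly_connected G"
  shows "connected G"
  using assms by (auto simp: strongly_connected_def intro!: connectedI reachable_mk_symmetricI)

section \<open>Postponing an element of a list\<close>

text \<open>The first element satisfying \<open>P\<close> goes to the end; without such an element
  the list is unchanged. This models saving the tree arc of a vertex for last.\<close>

definition postpone :: "('b \<Rightarrow> bool) \<Rightarrow> 'b list \<Rightarrow> 'b list" where
  "postpone P xs = takeWhile (\<lambda>x. \<not> P x) xs @ rotate1 (dropWhile (\<lambda>x. \<not> P x) xs)"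

lemma mset_postpone [simp]: "mset (postpone P xs) = mset xs"
proof -
  have "mset (rotate1 ys) = mset ys" for ys :: "'a list" by (cases ys) auto
  then show ?thesis unfolding postpone_def by (metis mset_append takeWhile_dropWhile_id)
qed

lemma set_postpone [simp]: "set (postpone P xs) = set xs"
  by (metis mset_postpone set_mset_mset)

lemma length_postpone [simp]: "length (postpone P xs) = length xs"
  by (metis mset_postpone size_mset)

lemma distinct_postpone [simp]: "distinct (postpone P xs) = distinct xs"
  by (metis mset_postpone mset_eq_imp_distinct_iff)

abbreviation first_index :: "('b \<Rightarrow> bool) \<Rightarrow> 'b list \<Rightarrow> nat" where
  "first_index P xs \<equiv> length (takeWhile (\<lambda>x. \<not> P x) xs)"

text \<open>The three cases match the three ways in which the algorithm picks a successor: before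
  the skip, after the skip, and the fallback to \<open>B\<close> past the last index.\<close>

lemma nth_postpone:
  assumes "i < length xs"
  shows "postpone P xs ! i =
    (if i < first_index P xs then xs ! i
     else if Suc i < length xs then xs ! Suc i
     else xs ! first_index P xs)"
proof -
  define ys zs where "ys = takeWhile (\<lambda>x. \<not> P x) xs" and "zs = dropWhile (\<lambda>x. \<not> P x) xs"
  have xs: "xs = ys @ zs" by (simp add: ys_def zs_def)
  have "(ys @ rotate1 zs) ! i =
    (if i < length ys then (ys @ zs) ! i
     else if Suc i < length (ys @ zs) then (ys @ zs) ! Suc i else (ys @ zs) ! length ys)"
    using assms unfolding xs
    by (cases zs) (auto simp: nth_append Suc_diff_le less_Suc_eq)
  then show ?thesis unfolding postpone_def ys_def[symmetric] zs_def[symmetric] xs[symmetric] .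
qed

lemma last_postpone:
  assumes "\<exists>x\<in>set xs. P x"
  shows "P (last (postpone P xs))"
proof -
  have "dropWhile (\<lambda>x. \<not> P x) xs \<noteq> []" using assms by auto
  then show ?thesis
    using hd_dropWhile[of "\<lambda>x. \<not> P x" xs]
    by (cases "dropWhile (\<lambda>x. \<not> P x) xs") (auto simp: postpone_def)
qed

section \<open>The loop invariant\<close>

locale hierholzer = fin_digraph G for G :: "(nat, 'b) pre_digraph" +
  fixes outs ins :: "nat \<Rightarrow> 'b list" and v0 :: nat
  assumes eulerian: "eulerian_digraph G"
    and orders: "arc_orders G outs ins"
    and v0_in_verts: "v0 \<in> verts G"
begin

lemma degree_eq: "v \<in> verts G \<Longrightarrow> out_degree G v = in_degree G v"
  using eulerian by (simp add: eulerian_digraph_def)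

lemma
  assumes "v \<in> verts G"
  shows distinct_outs: "distinct (outs v)" and set_outs: "set (outs v) = out_arcs G v"
    and distinct_ins: "distinct (ins v)" and set_ins: "set (ins v) = in_arcs G v"
  using orders assms by (auto simp: arc_orders_def)

lemma length_outs: "v \<in> verts G \<Longrightarrow> length (outs v) = out_degree G v"
  using distinct_card[OF distinct_outs] by (simp add: set_outs out_degree_def)

lemma length_ins: "v \<in> verts G \<Longrightarrow> length (ins v) = in_degree G v"
  using distinct_card[OF distinct_ins] by (simp add: set_ins in_degree_def)

text \<open>\<open>take\<close> stops at the end of the list, so the growth of \<open>nxt\<close>
  after the in-arcs are exhausted leaves this set alone.\<close>

definition used_in :: "hstate \<Rightarrow> 'b set" where
  "used_in s = (\<Union>v\<in>verts G. set (take (nxt s v) (ins v)))"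

text \<open>Counts the output edges that leave \<open>v\<close>. Truncated subtraction gives 0 while
  in-arcs are still being read, and \<open>skipped\<close> cancels the extra increment made by the
  skip.\<close>

definition exits :: "hstate \<Rightarrow> nat \<Rightarrow> nat" where
  "exits s v = nxt s v - in_degree G v - skipped s v"

text \<open>At \<open>v0\<close>, \<open>B\<close> has the junk value 0; whether an arc is postponed there is irrelevant.\<close>

abbreviation is_tree_arc :: "hstate \<Rightarrow> nat \<Rightarrow> 'b \<Rightarrow> bool" where
  "is_tree_arc s v \<equiv> \<lambda>e. head G e = B s v"

text \<open>The output shows only end vertices, so any arc to \<open>B s v\<close> can serve as the
  saved one; the first in \<open>outs v\<close> is taken, as that is where the algorithm
  skips.\<close>

definition exit_order :: "hstate \<Rightarrow> nat \<Rightarrow> 'b list" where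
  "exit_order s v = postpone (is_tree_arc s v) (outs v)"

definition used_out :: "hstate \<Rightarrow> 'b set" where
  "used_out s = (\<Union>v\<in>verts G. set (take (exits s v) (exit_order s v)))"

text \<open>
  The last clause says that every visited vertex has a path of \<open>B\<close> pointers to \<open>v0\<close>, in the form
  of an induction principle.
\<close>

definition loop_inv :: "hstate \<Rightarrow> 'b list \<Rightarrow> nat \<Rightarrow> bool" where
  "loop_inv s p c \<longleftrightarrow>
     trail v0 p c \<and> outp s = map (arc_to_ends G) p \<and> cnt s = length p \<and> set p = used_out s \<and>
     (\<forall>v\<in>verts G. skipped s v = of_bool (first_index (is_tree_arc s v) (outs v) < exits s v)) \<and>
     cur s \<in> verts G \<and> visited s (cur s) \<noteq> 0 \<and>
     arc_set_balanced (cur s) (used_in s) c \<and>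
     visited s v0 \<noteq> 0 \<and>
     (\<forall>v\<in>verts G. visited s v = 0 \<longrightarrow> nxt s v = 0) \<and>
     (\<forall>e\<in>used_in s. visited s (tail G e) \<noteq> 0) \<and>
     (\<forall>v\<in>verts G. visited s v \<noteq> 0 \<longrightarrow> v \<noteq> v0 \<longrightarrow> (\<exists>e\<in>out_arcs G v. is_tree_arc s v e)) \<and>
     (\<forall>S. v0 \<in> S \<longrightarrow> (\<forall>v\<in>verts G. visited s v \<noteq> 0 \<longrightarrow> v \<noteq> v0 \<longrightarrow> B s v \<in> S \<longrightarrow> v \<in> S) \<longrightarrow>
        (\<forall>v\<in>verts G. visited s v \<noteq> 0 \<longrightarrow> v \<in> S))"

lemma
  assumes "loop_inv s p c"
  shows inv_trail: "trail v0 p c" and inv_outp: "outp s = map (arc_to_ends G) p"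
    and inv_cnt: "cnt s = length p" and inv_set: "set p = used_out s"
    and inv_skipped [rule_format]:
      "\<forall>v\<in>verts G. skipped s v = of_bool (first_index (is_tree_arc s v) (outs v) < exits s v)"
    and inv_cur: "cur s \<in> verts G" and inv_visited_cur: "visited s (cur s) \<noteq> 0"
    and inv_balanced: "arc_set_balanced (cur s) (used_in s) c"
    and inv_visited_v0: "visited s v0 \<noteq> 0"
    and inv_unvisited [rule_format]: "\<forall>v\<in>verts G. visited s v = 0 \<longrightarrow> nxt s v = 0"
    and inv_tail [rule_format]: "\<forall>e\<in>used_in s. visited s (tail G e) \<noteq> 0"
    and inv_tree_arc [rule_format]: "\<forall>v\<in>verts G. visited s v \<noteq> 0 \<longrightarrow> v \<noteq> v0 \<longrightarrow>
      (\<exists>e\<in>out_arcs G v. is_tree_arc s v e)"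
    and inv_tree_induct [rule_format]: "\<forall>S. v0 \<in> S \<longrightarrow>
      (\<forall>v\<in>verts G. visited s v \<noteq> 0 \<longrightarrow> v \<noteq> v0 \<longrightarrow> B s v \<in> S \<longrightarrow> v \<in> S) \<longrightarrow>
      (\<forall>v\<in>verts G. visited s v \<noteq> 0 \<longrightarrow> v \<in> S)"
  by (insert assms, unfold loop_inv_def) (elim conjE, assumption)+

lemma set_exit_order: "v \<in> verts G \<Longrightarrow> set (exit_order s v) = out_arcs G v"
  by (simp add: exit_order_def set_outs)

lemma distinct_exit_order: "v \<in> verts G \<Longrightarrow> distinct (exit_order s v)"
  by (simp add: exit_order_def distinct_outs)

lemma length_exit_order: "v \<in> verts G \<Longrightarrow> length (exit_order s v) = out_degree G v"
  by (simp add: exit_order_def length_outs)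

lemma mem_used_out_iff:
  assumes "e \<in> arcs G"
  shows "e \<in> used_out s \<longleftrightarrow> e \<in> set (take (exits s (tail G e)) (exit_order s (tail G e)))"
  proof -
  have "tail G e = v" if "v \<in> verts G" "e \<in> set (take k (exit_order s v))" for v k
    using in_set_takeD[OF that(2)] that(1) by (simp add: set_exit_order)
  then show ?thesis using tail_in_verts[OF assms] unfolding used_out_def by blast
qed

lemma mem_used_in_iff:
  assumes "e \<in> arcs G"
  shows "e \<in> used_in s \<longleftrightarrow> e \<in> set (take (nxt s (head G e)) (ins (head G e)))"
proof -
  have "head G e = v" if "v \<in> verts G" "e \<in> set (take k (ins v))" for v k
    using in_set_takeD[OF that(2)] that(1) by (simp add: set_ins)
  then show ?thesis using head_in_verts[OF assms] unfolding used_in_def by blast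
qed

lemma used_in_subset: "used_in s \<subseteq> arcs G"
  by (auto simp: used_in_def dest!: in_set_takeD simp: set_ins)

lemma used_out_subset: "used_out s \<subseteq> arcs G"
  by (auto simp: used_out_def dest!: in_set_takeD simp: set_exit_order)

lemma in_arcs_subset_used_in:
  assumes "v \<in> verts G" "in_degree G v \<le> nxt s v"
  shows "in_arcs G v \<subseteq> used_in s"
  using assms by (auto simp: mem_used_in_iff length_ins set_ins)

lemma out_arcs_subset_used_out:
  assumes "v \<in> verts G" "out_degree G v \<le> exits s v"
  shows "out_arcs G v \<subseteq> used_out s"
  using assms by (auto simp: mem_used_out_iff length_exit_order set_exit_order)

lemma loop_inv_hinit: "loop_inv (hinit v0) [] v0"
  using v0_in_verts
  by (auto simp: loop_inv_def hinit_def trail_Nil_iff used_out_def used_in_def exits_def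
      arc_set_balanced_def arc_set_balance_def)

lemma finite_used_in: "finite (used_in s)"
  using finite_subset[OF used_in_subset] by simp

section \<open>Backward steps\<close>

text \<open>By balance the consumed in-arcs look like a trail from \<open>cur s\<close> to the end
  \<open>c\<close> of the output. The step prepends one arc to it and leaves the output, hence also
  \<open>p\<close> and \<open>c\<close>, as they are.\<close>

lemma loop_inv_backward:
  assumes inv: "loop_inv s p c" and less: "nxt s (cur s) < in_degree G (cur s)"
  defines "s' \<equiv> hstep G outs ins v0 s"
  shows "loop_inv s' p c" and "nxt s' = (nxt s)(cur s := Suc (nxt s (cur s)))" and "cnt s' = cnt s"
proof -
  define u where "u = cur s"
  define e where "e = ins u ! nxt s u"
  define v where "v = tail G e"
  have u: "u \<in> verts G" using inv_cur[OF inv] by (simp add: u_def)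
  have lt: "nxt s u < length (ins u)" using less u by (simp add: u_def length_ins)
  then have "e \<in> in_arcs G u" using set_ins[OF u] nth_mem unfolding e_def by blast
  then have e: "e \<in> arcs G" "head G e = u" by auto
  have v: "v \<in> verts G" using e by (simp add: v_def)
  \<comment> \<open>\<open>v0\<close> counts as visited from the start, so a fresh \<open>v\<close>
    differs from \<open>v0\<close> and does receive its \<open>B\<close> entry.\<close>
  have new: "visited s v = 0 \<Longrightarrow> v \<noteq> v0" and nz: "visited s u \<noteq> 0" "visited s v0 \<noteq> 0"
    using inv_visited_cur[OF inv] inv_visited_v0[OF inv] by (auto simp: u_def)
  have cur': "cur s' = v" and nxt': "nxt s' = (nxt s)(u := Suc (nxt s u))"
    and cnt': "cnt s' = cnt s" and outp': "outp s' = outp s" and skipped': "skipped s' = skipped s"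
    and visited': "visited s' = (visited s)(v := if visited s v = 0 then 1 else visited s v)"
    and B': "B s' = (if visited s v = 0 then (B s)(v := u) else B s)"
    using less new by (auto simp: s'_def hstep_def backward_step_def Gamma_in_def Let_def u_def e_def v_def)
  show "nxt s' = (nxt s)(cur s := Suc (nxt s (cur s)))" "cnt s' = cnt s"
    using nxt' cnt' by (simp_all add: u_def)
  have e_new: "e \<notin> used_in s"
  proof -
    have "e \<notin> set (take (nxt s u) (ins u))"
      using lt distinct_ins[OF u] by (auto simp: e_def in_set_conv_nth nth_eq_iff_index_eq)
    then show ?thesis using mem_used_in_iff[OF e(1)] e(2) by simp
  qed
  have used_in': "used_in s' = insert e (used_in s)"
  proof -
    have "set (take (nxt s' w) (ins w)) = set (take (nxt s w) (ins w)) \<union> (if w = u then {e} else {})"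
      for w using lt by (auto simp: nxt' e_def take_Suc_conv_app_nth)
    then show ?thesis using u unfolding used_in_def by (auto split: if_splits)
  qed
  \<comment> \<open>At \<open>u\<close> both the old and the new \<open>nxt\<close> are at most the
    in-degree, so truncation yields 0 both times.\<close>
  have exits': "exits s' w = exits s w" for w
    using less by (auto simp: exits_def nxt' skipped' u_def)
  have exits_new: "exits s v = 0" if "visited s v = 0"
    using inv_unvisited[OF inv v that] by (simp add: exits_def)
  \<comment> \<open>\<open>B\<close> changes only at a vertex with no exits so far, so reordering
    its exits cannot affect what has been output.\<close>
  have order': "exits s w = 0 \<or> B s' w = B s w" for w
    using exits_new by (auto simp: B')
  have used_out': "used_out s' = used_out s"
  proof -
    have "set (take (exits s' w) (exit_order s' w)) = set (take (exits s w) (exit_order s w))" for w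
      using order'[of w] by (auto simp: exits' exit_order_def)
    then show ?thesis by (simp add: used_out_def)
  qed
  have tree_arc': "\<exists>f\<in>out_arcs G w. is_tree_arc s' w f"
    if "w \<in> verts G" "visited s' w \<noteq> 0" "w \<noteq> v0" for w
  proof (cases "w = v \<and> visited s v = 0")
    case True
    \<comment> \<open>The arc \<open>e\<close> itself runs from \<open>v\<close> to
      \<open>u\<close>, the new \<open>B\<close> entry of \<open>v\<close>.\<close>
    then show ?thesis using e by (auto simp: B' v_def)
  next
    case False
    then have "visited s w \<noteq> 0" "B s' w = B s w" using that by (auto simp: visited' B' split: if_splits)
    then show ?thesis using inv_tree_arc[OF inv that(1) _ that(3)] by simp
  qed
  \<comment> \<open>The old pointers are unchanged, so the old principle puts every previously
    visited vertex into \<open>S\<close>, including \<open>u\<close>; a fresh \<open>v\<close>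
    follows because it points to \<open>u\<close>.\<close>
  have tree_induct': "w \<in> S"
    if S: "v0 \<in> S" "\<forall>w\<in>verts G. visited s' w \<noteq> 0 \<longrightarrow> w \<noteq> v0 \<longrightarrow> B s' w \<in> S \<longrightarrow> w \<in> S"
      and w: "w \<in> verts G" "visited s' w \<noteq> 0" for S w
  proof -
    have "x \<in> S" if "x \<in> verts G" "visited s x \<noteq> 0" "x \<noteq> v0" "B s x \<in> S" for x
    proof -
      have "visited s' x \<noteq> 0" "B s' x = B s x" using that(2) by (auto simp: visited' B')
      then show ?thesis using S(2) that by metis
    qed
    then have old: "x \<in> S" if "x \<in> verts G" "visited s x \<noteq> 0" for x
      using inv_tree_induct[OF inv S(1) _ that] by blast
    show ?thesis
    proof (cases "visited s w = 0")
      case True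
      then have "w = v" "visited s v = 0" using w(2) by (auto simp: visited' split: if_splits)
      then have "B s' w = u" "w \<noteq> v0" using new by (simp_all add: B')
      then show ?thesis using S(2) w old[OF u nz(1)] by metis
    qed (use old w(1) in blast)
  qed
  show "loop_inv s' p c"
    unfolding loop_inv_def
  proof (intro conjI ballI)
    show "skipped s' w = of_bool (first_index (is_tree_arc s' w) (outs w) < exits s' w)"
      if "w \<in> verts G" for w
      using inv_skipped[OF inv that] order'[of w] by (auto simp: exits' skipped')
    show "arc_set_balanced (cur s') (used_in s') c"
      unfolding cur' used_in' v_def using inv_balanced[OF inv] e e_new
      by (intro arc_set_balanced_insert_tail finite_used_in) (simp_all add: u_def)
    show "visited s' w = 0 \<longrightarrow> nxt s' w = 0" if "w \<in> verts G" for w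
      using inv_unvisited[OF inv that] nz(1) by (simp add: visited' nxt')
    show "visited s' (tail G f) \<noteq> 0" if "f \<in> used_in s'" for f
      using inv_tail[OF inv, of f] that by (auto simp: visited' used_in' v_def)
    show "visited s' w \<noteq> 0 \<longrightarrow> w \<noteq> v0 \<longrightarrow> (\<exists>f\<in>out_arcs G w. is_tree_arc s' w f)"
      if "w \<in> verts G" for w using tree_arc' that by blast
    show "\<forall>S. v0 \<in> S \<longrightarrow>
        (\<forall>w\<in>verts G. visited s' w \<noteq> 0 \<longrightarrow> w \<noteq> v0 \<longrightarrow> B s' w \<in> S \<longrightarrow> w \<in> S) \<longrightarrow>
        (\<forall>w\<in>verts G. visited s' w \<noteq> 0 \<longrightarrow> w \<in> S)"
      using tree_induct' by (intro allI impI ballI)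
  qed (use v nz in \<open>simp_all add: outp' cnt' cur' used_out' visited'
      inv_trail[OF inv] inv_outp[OF inv] inv_cnt[OF inv] inv_set[OF inv]\<close>)
qed

section \<open>A stuck output trail is complete\<close>

lemma loop_inv_stuck:
  assumes inv: "loop_inv s p c" and c: "in_degree G c \<le> nxt s c" "out_arcs G c \<subseteq> set p"
  shows "set p = arcs G"
proof -
  have trail: "trail v0 p c" and p: "set p = used_out s"
    using inv_trail[OF inv] inv_set[OF inv] by simp_all
  have bal: "arc_set_balanced v0 (set p) c" using arc_balancedI_trail[OF trail] .
  have cv: "c \<in> verts G" using trail by (auto simp: trail_def)
  have c_eq: "c = v0"
    using arc_set_balanced_out_arcs_subset[OF bal cv degree_eq[OF cv] c(2)] by simp
  define S where "S = {v\<in>verts G. out_arcs G v \<subseteq> set p}"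
  \<comment> \<open>The trail is closed, so it may be regarded as starting and ending at any vertex
    \<open>v\<close>.\<close>
  have in_S: "in_arcs G v \<subseteq> set p" if "v \<in> S" for v
    using arc_set_balanced_out_arcs_subset[of v "set p" v] that degree_eq bal
    by (auto simp: S_def c_eq arc_set_balanced_refl_iff[of v0 _ v])
  have "v \<in> S" if v: "v \<in> verts G" "visited s v \<noteq> 0" "v \<noteq> v0" "B s v \<in> S" for v
  proof -
    have ex: "\<exists>e\<in>out_arcs G v. is_tree_arc s v e" using inv_tree_arc[OF inv v(1-3)] .
    \<comment> \<open>The last exit of \<open>v\<close> leads to \<open>B s v\<close>. It is thus an
      in-arc of a vertex of \<open>S\<close> and has been output; since it comes last, all other
      exits of \<open>v\<close> have been output too.\<close>
    define l where "l = last (exit_order s v)"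
    have ne: "exit_order s v \<noteq> []" using ex set_exit_order[OF v(1), of s] by auto
    have "is_tree_arc s v l"
      unfolding l_def exit_order_def
      using ex last_postpone[of "outs v" "is_tree_arc s v"] by (simp add: set_outs v(1))
    moreover have l: "l \<in> out_arcs G v"
      using last_in_set[OF ne] set_exit_order[OF v(1), of s] by (simp add: l_def)
    ultimately have "l \<in> used_out s" using in_S[OF v(4)] p by auto
    then have "l \<in> set (take (exits s v) (exit_order s v))" using l by (auto simp: mem_used_out_iff)
    then have "out_degree G v \<le> exits s v"
      using distinct_exit_order[OF v(1), of s] ne
      by (auto simp: l_def last_conv_nth in_set_conv_nth nth_eq_iff_index_eq length_exit_order[OF v(1)])
    then show ?thesis using out_arcs_subset_used_out[OF v(1)] v(1) p by (simp add: S_def)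
  qed
  moreover have "v0 \<in> S" using c v0_in_verts by (simp add: S_def c_eq)
  ultimately have visited_S: "v \<in> S" if "v \<in> verts G" "visited s v \<noteq> 0" for v
    using inv_tree_induct[OF inv _ _ that] by blast
  \<comment> \<open>This passes from output arcs to arcs read backwards. If \<open>v\<close> still
    had unread in-arcs, it would have no exits; as \<open>v\<close> lies in \<open>S\<close>, it
    would have no out-arcs, hence no in-arcs either.\<close>
  have in_used: "in_arcs G v \<subseteq> used_in s" if v: "v \<in> S" for v
  proof (cases "in_degree G v \<le> nxt s v")
    case True
    then show ?thesis using v by (intro in_arcs_subset_used_in) (auto simp: S_def)
  next
    case False
    then have "exits s v = 0" by (simp add: exits_def)
    have "out_arcs G v = {}"
    proof (rule equals0I)
      fix e assume "e \<in> out_arcs G v"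
      then show False using v p \<open>exits s v = 0\<close> by (auto simp: S_def mem_used_out_iff dest!: subsetD)
    qed
    then have "in_degree G v = 0" using degree_eq[of v] v by (simp add: S_def out_degree_def)
    then show ?thesis using False by simp
  qed
  \<comment> \<open>Tails of read arcs are visited, so \<open>S\<close> is closed under predecessors
    and contains every vertex with a walk to \<open>v0\<close>.\<close>
  have step: "tail G e \<in> S" if "e \<in> arcs G" "head G e \<in> S" for e
    using that in_used[OF that(2)] by (intro visited_S inv_tail[OF inv]) auto
  have "v \<in> S" if "awalk v q v0" for v q
    using that
  proof (induction q arbitrary: v)
    case Nil
    then show ?case using \<open>v0 \<in> S\<close> by (simp add: awalk_Nil_iff)
  next
    case (Cons e q)
    then show ?case using step by (auto simp: awalk_Cons_iff)
  qed
  then have "v \<in> S" if "v \<in> verts G" for v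
    using eulerian that v0_in_verts
    unfolding eulerian_digraph_def strongly_connected_def reachable_awalk by blast
  then have "arcs G \<subseteq> set p" by (force simp: S_def)
  then show ?thesis using used_out_subset p by blast
qed

section \<open>Forward steps\<close>

text \<open>The skip test and the target become parameters, so that they can be replaced by the
  values computed from the invariant: \<open>k = j\<close> and \<open>head G e\<close> in
  \<open>loop_inv_forward\<close>.\<close>

lemma forward_step_eq:
  assumes "cur s = u" and "i = nxt s u - in_degree G u"
    and "skip \<longleftrightarrow> i \<le> out_degree G u \<and> Gamma_out G outs u i = B s u \<and> skipped s u = 0"
    and "v = (let i' = i + of_bool skip in
      if out_degree G u < i' then B s u else Gamma_out G outs u i')"
  shows "forward_step G outs s =
    (let s1 = if skip then s\<lparr>skipped := (skipped s)(u := 1), nxt := (nxt s)(u := nxt s u + 1)\<rparr> else s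
     in s1\<lparr>outp := outp s1 @ [(u, v)], cnt := cnt s1 + 1, cur := v\<rparr>)"
proof -
  have eq: "forward_step G outs s = (let i' = if skip then i + 1 else i;
    s1 = if skip then s\<lparr>skipped := (skipped s)(u := 1), nxt := (nxt s)(u := nxt s u + 1)\<rparr> else s;
    w = if i' > out_degree G u then B s1 u else Gamma_out G outs u i' in 
   s1\<lparr>outp := outp s1 @ [(u, w)], cnt := cnt s1 + 1, cur := w\<rparr>)"
   unfolding forward_step_def assms(1,2,3) Let_def by (rule refl)
  have B: "B (s\<lparr>skipped := f, nxt := g\<rparr>) = B s" for f g by simp
  show ?thesis
  proof (cases skip)
    case True
    have "v = (if out_degree G u < i + 1 then B s u else Gamma_out G outs u (i + 1))"
      unfolding assms(4) using True by (simp add: Let_def)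
    then show ?thesis using True unfolding eq by (simp only: if_True Let_def B)
  next
    case False
    have "v = (if out_degree G u < i then B s u else Gamma_out G outs u i)"
      unfolding assms(4) using False by (simp add: Let_def)
    then show ?thesis using False unfolding eq by (simp only: if_False Let_def)
  qed
qed

lemma forward_step_simps:
  assumes "cur s = u" and "i = nxt s u - in_degree G u"
    and "skip \<longleftrightarrow> i \<le> out_degree G u \<and> Gamma_out G outs u i = B s u \<and> skipped s u = 0"
    and "v = (let i' = i + of_bool skip in
      if out_degree G u < i' then B s u else Gamma_out G outs u i')"
  defines "s' \<equiv> forward_step G outs s"
  shows "nxt s' = (nxt s)(u := nxt s u + of_bool skip)"
    and "skipped s' = (if skip then (skipped s)(u := 1) else skipped s)"
    and "outp s' = outp s @ [(u, v)]" and "cnt s' = Suc (cnt s)" and "cur s' = v"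
    and "visited s' = visited s" and "B s' = B s"
  using forward_step_eq[OF assms(1-4)]
  unfolding s'_def by (cases skip; simp only: if_True if_False Let_def; simp)+


text \<open>With all in-arcs of the current vertex read, balance shows that it is the end
  \<open>c\<close> of the output and that its out-arcs have been read. The edge written is then the
  next entry of \<open>exit_order\<close>.\<close>

lemma loop_inv_forward:
  assumes inv: "loop_inv s p c" and ge: "in_degree G (cur s) \<le> nxt s (cur s)"
    and cnt: "cnt s < card (arcs G)"
  defines "s' \<equiv> hstep G outs ins v0 s"
  shows "\<exists>e. loop_inv s' (p @ [e]) (head G e)"
    and "\<And>v. nxt s v \<le> nxt s' v" and "cnt s' = Suc (cnt s)"
proof -
  define u where "u = cur s"
  have u: "u \<in> verts G" and trail: "trail v0 p c" and p: "set p = used_out s"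
    using inv_cur[OF inv] inv_trail[OF inv] inv_set[OF inv] by (simp_all add: u_def)
  have ge_u: "in_degree G u \<le> nxt s u" using ge by (simp add: u_def)
  have bal: "arc_set_balanced u (used_in s) c" using inv_balanced[OF inv] by (simp add: u_def)
  have c: "c = u" and out_used: "out_arcs G u \<subseteq> used_in s"
    using arc_set_balanced_in_arcs_subset[OF bal u degree_eq[OF u] in_arcs_subset_used_in[OF u ge_u]]
    by blast+
  define k where "k = exits s u"
  have k: "k < out_degree G u"
  proof (rule ccontr)
    \<comment> \<open>Without a remaining exit the trail would be stuck and so contain all arcs,
      against the loop condition.\<close>
    assume "\<not> k < out_degree G u"
    then have "out_arcs G c \<subseteq> set p" using out_arcs_subset_used_out[OF u] by (simp add: k_def c p)
    then have "set p = arcs G" using loop_inv_stuck[OF inv] ge_u by (simp add: c)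
    then have "length p = card (arcs G)" using trail distinct_card[of p] by (simp add: trail_def)
    then show False using inv_cnt[OF inv] cnt by simp
  qed
  define e where "e = exit_order s u ! k"
  \<comment> \<open>The position at which the skip happens; it equals the out-degree if no arc leads
    to \<open>B s u\<close>, which can occur only at \<open>v0\<close>.\<close>
  define j where "j = first_index (is_tree_arc s u) (outs u)"
  have k_len: "k < length (exit_order s u)" using k u by (simp add: length_exit_order)
  then have "e \<in> set (exit_order s u)" by (simp add: e_def)
  then have e: "e \<in> arcs G" "tail G e = u" by (simp_all add: set_exit_order u)
  have sk: "skipped s u = of_bool (j < k)" using inv_skipped[OF inv u] by (simp add: j_def k_def)
  \<comment> \<open>The truncated subtractions are exact: a nonzero \<open>skipped\<close> entry
    entails \<open>0 < k\<close>.\<close>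
  have nxt_u: "nxt s u = in_degree G u + k + of_bool (j < k)"
  proof -
    have "k = nxt s u - in_degree G u - skipped s u" by (simp add: k_def exits_def)
    moreover have "skipped s u = 0 \<or> skipped s u = 1 \<and> 0 < k" using sk by simp
    ultimately have "nxt s u = in_degree G u + k + skipped s u" using ge_u by linarith
    then show ?thesis unfolding sk .
  qed
  have before: "head G (outs u ! i) \<noteq> B s u" if "i < j" for i
    using that set_takeWhileD[OF nth_mem, of i "\<lambda>e. \<not> is_tree_arc s u e" "outs u"]
    by (simp add: j_def takeWhile_nth)
  have at_j: "head G (outs u ! j) = B s u" if "j < out_degree G u"
    using that nth_length_takeWhile[of "\<lambda>e. \<not> is_tree_arc s u e" "outs u"]
    by (simp add: j_def length_outs u)
  have head_e: "head G e = (if k < j then head G (outs u ! k)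
      else if Suc k < out_degree G u then head G (outs u ! Suc k) else B s u)"
  proof -
    have "e = (if k < j then outs u ! k
        else if Suc k < out_degree G u then outs u ! Suc k else outs u ! j)"
      using nth_postpone[of k "outs u" "is_tree_arc s u"] k
      by (simp only: e_def exit_order_def length_outs[OF u] j_def)
    moreover have "head G (outs u ! j) = B s u" if "\<not> k < j" using that k by (intro at_j) simp
    ultimately show ?thesis by simp
  qed
  define i where "i = Suc (nxt s u) - in_degree G u"
  have i: "i = Suc (k + of_bool (j < k))" by (simp add: i_def nxt_u)
  \<comment> \<open>\<open>i\<close> counts from 1, so position \<open>k\<close> of
    \<open>outs u\<close> is tested as long as nothing was skipped. Before \<open>j\<close> no head
    equals \<open>B s u\<close>; after \<open>j\<close> the flag is already set.\<close>
  have skip_iff: "i \<le> out_degree G u \<and> Gamma_out G outs u i = B s u \<and> skipped s u = 0 \<longleftrightarrow> k = j"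
  proof (cases k j rule: linorder_cases)
    case less
    then show ?thesis using before[OF less] by (simp add: i Gamma_out_def)
  next
    case equal
    then show ?thesis using k at_j sk by (simp add: i Gamma_out_def)
  next
    case greater
    then show ?thesis using sk by simp
  qed
  \<comment> \<open>After the adjustment the index is \<open>k + 1\<close> if \<open>k < j\<close>
    and \<open>k + 2\<close> otherwise. It exceeds the out-degree only at the last exit, where
    \<open>B s u\<close> is the head of the saved arc.\<close>
  have target: "head G e = (let i' = i + of_bool (k = j) in
      if out_degree G u < i' then B s u else Gamma_out G outs u i')"
    using k by (cases k j rule: linorder_cases) (auto simp: i head_e Gamma_out_def)
  define s1 where "s1 = s\<lparr>nxt := (nxt s)(u := Suc (nxt s u))\<rparr>"
  have s1: "cur s1 = u" "i = nxt s1 u - in_degree G u" "nxt s1 = (nxt s)(u := Suc (nxt s u))"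
    "B s1 = B s" "skipped s1 = skipped s" "outp s1 = outp s" "cnt s1 = cnt s" "visited s1 = visited s"
    by (simp_all add: s1_def i_def u_def)
  have s': "s' = forward_step G outs s1"
    using ge_u by (simp add: s'_def s1_def hstep_def Let_def u_def)
  note simps = forward_step_simps[OF s1(1,2), unfolded s1(4,5), OF skip_iff[symmetric] target]
  have nxt': "nxt s' = (nxt s)(u := Suc (nxt s u) + of_bool (k = j))"
    and skipped': "skipped s' = (if k = j then (skipped s)(u := 1) else skipped s)"
    and outp': "outp s' = outp s @ [(u, head G e)]" and cnt': "cnt s' = Suc (cnt s)"
    and cur': "cur s' = head G e" and visited': "visited s' = visited s" and B': "B s' = B s"
    unfolding s' simps s1(3-) by simp_all
  show "nxt s v \<le> nxt s' v" for v by (simp add: nxt')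
  show "cnt s' = Suc (cnt s)" by (rule cnt')
  \<comment> \<open>If \<open>k = j\<close>, then \<open>nxt\<close> grows by 2 and
    \<open>skipped\<close> by 1, so the count still grows by exactly 1.\<close>
  have exits': "exits s' v = (if v = u then Suc k else exits s v)" for v
    using sk by (cases k j rule: linorder_cases) (simp_all add: exits_def nxt' skipped' nxt_u)
  have exit_order': "exit_order s' = exit_order s" by (rule ext) (simp add: exit_order_def B')
  have used_in': "used_in s' = used_in s"
  proof -
    have "take (nxt s' v) (ins v) = take (nxt s v) (ins v)" if "v \<in> verts G" for v
      using that ge_u by (auto simp: nxt' length_ins)
    then show ?thesis by (simp add: used_in_def)
  qed
  have used_out': "used_out s' = insert e (used_out s)"
  proof -
    have "set (take (exits s' v) (exit_order s' v))
        = set (take (exits s v) (exit_order s v)) \<union> (if v = u then {e} else {})" for v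
      using k_len by (auto simp: exits' exit_order' k_def[symmetric] take_Suc_conv_app_nth e_def)
    then show ?thesis using u unfolding used_out_def by (auto split: if_splits)
  qed
  have e_new: "e \<notin> set p"
  proof -
    have "e \<notin> set (take k (exit_order s u))"
      using k_len distinct_exit_order[OF u, of s]
      by (auto simp: e_def in_set_conv_nth nth_eq_iff_index_eq)
    then show ?thesis using mem_used_out_iff[OF e(1)] e(2) by (simp add: p k_def)
  qed
  have trail': "trail v0 (p @ [e]) (head G e)"
    using trail e e_new arc_implies_awalk[OF e(1)] by (auto simp: trail_def c intro: awalk_appendI)
  have head_verts: "head G e \<in> verts G" using e by simp
  \<comment> \<open>The arc \<open>e\<close> was read backwards at its head, so the head has a
    positive \<open>nxt\<close> entry and must be visited.\<close>
  have "e \<in> used_in s" using out_used e by auto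
  then have "nxt s (head G e) \<noteq> 0" using mem_used_in_iff[OF e(1), of s] by (intro notI) simp
  then have head_visited: "visited s (head G e) \<noteq> 0" using inv_unvisited[OF inv head_verts] by auto
  have "loop_inv s' (p @ [e]) (head G e)"
    unfolding loop_inv_def
  proof (intro conjI ballI allI impI)
    show "skipped s' v = of_bool (first_index (is_tree_arc s' v) (outs v) < exits s' v)"
      if "v \<in> verts G" for v
    proof (cases "v = u")
      case True
      then show ?thesis unfolding skipped' exits' B' using sk by (auto simp flip: j_def)
    next
      case False
      then show ?thesis using inv_skipped[OF inv that] by (simp add: skipped' exits' B')
    qed
    \<comment> \<open>Since \<open>c = u\<close>, all balances are 0, and the closed walk may be
      based at \<open>head G e\<close> instead.\<close>
    show "arc_set_balanced (cur s') (used_in s') (head G e)"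
      using bal arc_set_balanced_refl_iff[of u _ "head G e"] by (simp only: c cur' used_in')
    show "nxt s' v = 0" if "v \<in> verts G" "visited s' v = 0" for v
      using inv_unvisited[OF inv that(1)] that inv_visited_cur[OF inv]
      by (auto simp: visited' nxt' u_def)
    show "visited s' (tail G f) \<noteq> 0" if "f \<in> used_in s'" for f
      using inv_tail[OF inv] that by (simp add: visited' used_in')
    show "\<exists>f\<in>out_arcs G v. is_tree_arc s' v f"
      if "v \<in> verts G" "visited s' v \<noteq> 0" "v \<noteq> v0" for v
      using inv_tree_arc[OF inv that(1) _ that(3)] that by (simp add: visited' B')
    show "v \<in> S"
      if "v0 \<in> S" "\<forall>v\<in>verts G. visited s' v \<noteq> 0 \<longrightarrow> v \<noteq> v0 \<longrightarrow> B s' v \<in> S \<longrightarrow> v \<in> S"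
        "v \<in> verts G" "visited s' v \<noteq> 0" for S v
      using inv_tree_induct[OF inv that(1) _ that(3)] that unfolding visited' B' by blast
  qed (use trail' head_verts head_visited e in \<open>simp_all add: outp' cnt' cur' used_out' visited' B'
      arc_to_ends_def inv_outp[OF inv] inv_cnt[OF inv] inv_set[OF inv]
      inv_visited_v0[OF inv]\<close>)
  then show "\<exists>e. loop_inv s' (p @ [e]) (head G e)" by blast
qed

section \<open>Termination and correctness\<close>

lemma euler_trail_output:
  "\<exists>p. space_efficient_hierholzer G outs ins v0 = Some (map (arc_to_ends G) p) \<and> euler_trail v0 p v0"
proof -
  let ?P = "\<lambda>s. \<exists>p c. loop_inv s p c"
  let ?b = "\<lambda>s. cnt s < card (arcs G)" and ?step = "hstep G outs ins v0"
  \<comment> \<open>Unread in-arcs plus unwritten edges: a backward step lowers the first summand, a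
    forward step the second.\<close>
  define rank where
    "rank s = (\<Sum>v\<in>verts G. in_degree G v - nxt s v) + (card (arcs G) - cnt s)" for s :: hstate
  have step: "?P (?step s) \<and> rank (?step s) < rank s" if P: "?P s" and b: "?b s" for s
  proof -
    obtain p c where inv: "loop_inv s p c" using P by blast
    show ?thesis
    proof (cases "nxt s (cur s) < in_degree G (cur s)")
      case True
      note backward = loop_inv_backward[OF inv True]
      have "(\<Sum>v\<in>verts G. in_degree G v - nxt (?step s) v) < (\<Sum>v\<in>verts G. in_degree G v - nxt s v)"
        using True inv_cur[OF inv]
        by (intro sum_strict_mono_ex1) (auto simp: backward(2) intro!: bexI[of _ "cur s"])
      then show ?thesis using backward(1,3) by (auto simp: rank_def)
    next
      case False
      then have ge: "in_degree G (cur s) \<le> nxt s (cur s)" by simp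
      note forward = loop_inv_forward[OF inv ge b]
      have "(\<Sum>v\<in>verts G. in_degree G v - nxt (?step s) v) \<le> (\<Sum>v\<in>verts G. in_degree G v - nxt s v)"
        using forward(2) by (intro sum_mono diff_le_mono2)
      then show ?thesis using forward(1,3) b by (auto simp: rank_def)
    qed
  qed
  have init: "?P (hinit v0)" using loop_inv_hinit by blast
  obtain t where t: "while_option ?b ?step (hinit v0) = Some t"
    using measure_while_option_Some[of ?P ?b ?step rank, OF step init] by blast
  have "?P t" using while_option_rule[of ?P, OF _ t init] step by blast
  then obtain p c where inv: "loop_inv t p c" by blast
  have trail: "trail v0 p c" and "cnt t = length p" and p: "set p = used_out t"
    using inv_trail[OF inv] inv_cnt[OF inv] inv_set[OF inv] by simp_all
  then have "card (arcs G) \<le> card (set p)"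
    using while_option_stop[OF t] distinct_card[of p] by (simp add: trail_def)
  then have arcs: "set p = arcs G" using used_out_subset p by (intro card_seteq) auto
  then have "c = v0" using in_degree_eq_out_degree_imp_closed[OF trail arcs degree_eq] by simp
  \<comment> \<open>Connectivity turns a trail through all arcs into an \<open>euler_trail\<close>,
    which also has to meet every vertex.\<close>
  moreover have "connected G"
    using eulerian by (simp add: eulerian_digraph_def strongly_connected_imp_connected)
  ultimately have "euler_trail v0 p v0" using trail arcs by (simp add: euler_trail_conv_connected)
  then show ?thesis using t inv_outp[OF inv] by (auto simp: space_efficient_hierholzer_def)
qed

end

section \<open>From arcs to the vertex sequence\<close>

lemma (in pre_digraph) map_arc_to_ends_conv_awalk_verts:
  assumes "cas u p v"
  shows "map (arc_to_ends G) p
    = map (\<lambda>j. (awalk_verts u p ! j, awalk_verts u p ! (j + 1))) [0..<length p]"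
proof (rule nth_equalityI)
  fix i assume "i < length (map (arc_to_ends G) p)"
  then have i: "i < length p" by simp
  then have "p \<noteq> []" by auto
  then have "awalk_verts u p ! i = tail G (p ! i)"
    using i by (simp add: awalk_verts_conv nth_append)
  moreover have "awalk_verts u p ! (i + 1) = head G (p ! i)"
    using i \<open>p \<noteq> []\<close> by (simp add: awalk_verts_conv'[OF assms])
  ultimately show "map (arc_to_ends G) p ! i
      = map (\<lambda>j. (awalk_verts u p ! j, awalk_verts u p ! (j + 1))) [0..<length p] ! i"
    using i by (simp add: arc_to_ends_def)
qed simp

text \<open>Each arc occurs at exactly one position, so indexing is a bijection; multiplicities of
  parallel arcs become counts of output positions.\<close>

lemma card_nth_eq:
  assumes "distinct p"
  shows "card {j. j < length p \<and> f (p ! j) = z} = card {e \<in> set p. f e = z}"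
proof (rule bij_betw_same_card)
  show "bij_betw ((!) p) {j. j < length p \<and> f (p ! j) = z} {e \<in> set p. f e = z}"
    using assms by (auto simp: bij_betw_def inj_on_def nth_eq_iff_index_eq in_set_conv_nth)
qed

theorem theorem11:
  fixes G :: "(nat, 'b) pre_digraph"
    and n m v0 :: nat
    and outs ins :: "nat \<Rightarrow> 'b list"
  assumes "fin_digraph G"
    and "verts G = {1..n}"
    and "card (arcs G) = m" and "m \<ge> 1"
    and "eulerian_digraph G"
    and "arc_orders G outs ins"
    and "v0 \<in> {1..n}"
  shows "\<exists>u :: nat \<Rightarrow> nat.
           space_efficient_hierholzer G outs ins v0
             = Some (map (\<lambda>j. (u j, u (j + 1))) [0..<m]) \<and>
           (\<exists>p. pre_digraph.euler_trail G (u 0) p (u m) \<and>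
                map (arc_to_ends G) p = map (\<lambda>j. (u j, u (j + 1))) [0..<m]) \<and>
           u m = u 0 \<and>
           (\<forall>x \<in> verts G. \<forall>y \<in> verts G.
              card {j. j < m \<and> (u j, u (j + 1)) = (x, y)}
                = card {e \<in> arcs G. arc_to_ends G e = (x, y)})"
proof -
  interpret fin_digraph G by fact
  interpret hierholzer G outs ins v0
    using assms by unfold_locales auto
  obtain p where run: "space_efficient_hierholzer G outs ins v0 = Some (map (arc_to_ends G) p)"
    and euler: "euler_trail v0 p v0"
    using euler_trail_output by blast
  have p: "awalk v0 p v0" "distinct p" "set p = arcs G"
    using euler by (auto simp: euler_trail_def trail_def)
  have len: "length p = m" using p assms(3) distinct_card by fastforce
  \<comment> \<open>The witness lists the \<open>m + 1\<close> vertices met by the Euler trail,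
    starting and ending at \<open>v0\<close>.\<close>
  define u where "u = (!) (awalk_verts v0 p)"
  have ends: "map (arc_to_ends G) p = map (\<lambda>j. (u j, u (j + 1))) [0..<m]"
    using map_arc_to_ends_conv_awalk_verts[of v0 p v0] p(1) unfolding u_def len by (simp add: awalk_def)
  have u0: "u 0 = v0" using p(1) by (simp add: u_def flip: hd_conv_nth)
  have um: "u m = v0"
    using p(1) last_conv_nth[of "awalk_verts v0 p"] by (simp add: u_def length_awalk_verts len)
  have "(u j, u (j + 1)) = arc_to_ends G (p ! j)" if "j < m" for j
    using that arg_cong[OF ends, of "\<lambda>xs. xs ! j"] by (simp add: len)
  then have "{j. j < m \<and> (u j, u (j + 1)) = z} = {j. j < length p \<and> arc_to_ends G (p ! j) = z}" for z
    using len by auto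
  then have "card {j. j < m \<and> (u j, u (j + 1)) = z} = card {e \<in> arcs G. arc_to_ends G e = z}" for z
    using card_nth_eq[OF p(2), of "arc_to_ends G"] by (simp add: p(3))
  then show ?thesis using run euler ends u0 um by (intro exI[of _ u]) auto
qed

end
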